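(* Let $\theta$ be a normal classical integer of value $n$. Then (up to renaming of bound variables) $\theta=\lambda x\lambda f\,u$ for some $u\in N_{x,f}$ without free $\mu$-variables such that $\mathrm{val}(u)=\{n\}$.
   Context: **$\lambda\mu$-terms.** There are two disjoint alphabets of variables: $\lambda$-variables $x,y,z,\dots$ and $\mu$-variables $\alpha,\beta,\gamma,\dots$. Terms are generated by: a $\lambda$-variable $x$; $\lambda x\,u$; application $(u)v$; and $\mu\alpha[\beta]t$ ($\alpha,\beta$ $\mu$-variables, possibly equal, $t$ a term). $\lambda x$ binds $x$ and $\mu\alpha$ binds $\alpha$. An expression $[\alpha]t$ is called a named term (named by $\alpha$). Terms are considered up to renaming of bound variables; in each term the free and bound variables are assumed distinct and each bound variable is bound only once. Below, in $\mu\alpha u$, $u$ denotes a named term. $(f)^n x$ denotes $(f)(f)\cdots(f)x$ ($n$ times). **Reduction.** Computation rules: $(C_1)$ $(\lambda x u)v\to u[v/x]$; $(C_2)$ $(\mu\alpha u)v\to\mu\alpha\,u[v/{*}\alpha]$, where $u[v/{*}\alpha]$ is obtained by inductively replacing each subterm $[\alpha]w$ of $u$ by $[\alpha](w)v$. Simplification rules: $(S_1)$ $[\alpha]\mu\beta u\to u[\alpha/\beta]$; $(S_2)$ $\mu\alpha[\alpha]u\to u$ if $\alpha$ is not free in $u$; $(S_3)$ $\mu\alpha u\to\lambda x\mu\alpha\,u[x/{*}\alpha]$ ($x$ fresh) if $u$ contains a subterm of the form $[\alpha]\lambda y w$. A term is normal if none of the rules $C_1,C_2,S_1,S_2,S_3$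 applies to any of its subterms. **Types.** Types are formulas of second-order predicate logic built with $\bot,\to,\forall$ (first-order and second-order quantifiers), in a language containing a constant $0$ and a unary function symbol $s$. $F_1,\dots,F_n\to G$ denotes $F_1\to(F_2\to\cdots(F_n\to G))$. Fix a set $E$ of equations between first-order terms; $\vdash_E u=v$ means $u=v$ is a consequence of $E$. $E$ is assumed adequate for integers: $\not\vdash_E s(a)=0$, and $\vdash_E s(a)=s(b)$ implies $\vdash_E a=b$. Judgments have the form $\Gamma\vdash t:A,\Delta$, where $\Gamma=x_1:A_1,\dots,x_n:A_n$ and $\Delta=\alpha_1:B_1,\dots,\alpha_m:B_m$ are regarded as sets (so contraction is implicit) and distinct formulas do not carry the same label. Rules: (1) $\Gamma\vdash x_i:A_i,\Delta$. (2) From $\Gamma,x:A\vdash t:B,\Delta$ infer $\Gamma\vdash\lambda x t:A\to B,\Delta$. (3) From $\Gamma\vdash u:A\to B,\Delta$ and $\Gamma\vdash v:A,\Delta$ infer $\Gamma\vdash(u)v:B,\Delta$. (4) From $\Gamma\vdash t:A,\Delta$ infer $\Gamma\vdash t:\forall xA,\Delta$, if $x$ is not free in $\Gamma,\Delta$. (5) From $\Gamma\vdash t:\forall xA,\Delta$ infer $\Gamma\vdash t:A[u/x],\Delta$, $u$ a first-order term. (6) From $\Gamma\vdash t:A,\Delta$ infer $\Gamma\vdash t:\forall XA,\Delta$, if $X$ is not free in $\Gamma,\Delta$. (7) From $\Gamma\vdash t:\forall XA,\Delta$ infer $\Gamma\vdash t:A[G/X],\Delta$, $G$ a formula. (8)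 From $\Gamma\vdash t:A[u/x],\Delta$ infer $\Gamma\vdash t:A[v/x],\Delta$, if $\vdash_E u=v$. (9) From $\Gamma\vdash t:A,\beta:B,\Delta$ infer $\Gamma\vdash\mu\beta[\alpha]t:B,\alpha:A,\Delta$ if $\alpha\neq\beta$, and $\Gamma\vdash\mu\alpha[\alpha]t:B,\Delta$ if $\alpha=\beta$ (in which case $A=B$). Weakening is included in rules (2) and (9): the discharged hypothesis $x:A$, respectively $\beta:B$, need not actually occur in the premise. **Classical integers.** $N[x]=\forall X\{X(0),\forall y(X(y)\to X(sy))\to X(x)\}$ with $X$ a unary relation variable. A classical integer of value $n$ is a closed $\lambda\mu$-term $\theta$ such that $\vdash\theta:N[s^n(0)]$. **The set $N_{x,f}$.** Fix two $\lambda$-variables $x,f$. $N_{x,f}$ is the smallest set of $\lambda\mu$-terms with: $x\in N_{x,f}$; $\mu\alpha[\beta]x\in N_{x,f}$; if $u\in N_{x,f}$ then $(f)u\in N_{x,f}$ and $\mu\alpha[\beta](f)u\in N_{x,f}$ (for all $\mu$-variables $\alpha,\beta$). **The set $\mathrm{val}(u)$**, defined inductively for $u\in N_{x,f}$ (and for terms of the forms occurring as subterms of such $u$): $\mathrm{val}(x)=\{0\}$; $\mathrm{val}((f)u)=\{n+1: n\in\mathrm{val}(u)\}$; $\mathrm{val}(\mu\alpha[\beta]u)=\bigcup\mathrm{val}(v)$, the union over all subterms $[\alpha]v$ of $[\beta]u$ (including $[\beta]u$ itself if $\beta=\alpha$; an empty union is $\emptyset$). *)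

theory Defs
  imports Main
begin

section \<open>The lambda-mu-calculus\<close>

text \<open>Terms up to renaming of bound variables are represented with de Bruijn indices; there are
  two independent index spaces, one for lambda-variables (bound by \<open>Lam\<close>) and one for
  mu-variables (bound by \<open>Mu\<close>). \<open>Name a t\<close> is the named term \<open>[a]t\<close>, so that
  \<open>Mu (Name b t)\<close> is the term \<open>\<mu>\<alpha>[\<beta>]t\<close>, with \<open>b = 0\<close> iff \<open>\<beta> = \<alpha>\<close>.\<close>

datatype trm = LVar nat | Lam trm | App trm trm | Mu named
  and named = Name nat trm

subsection \<open>Free variables\<close>

primrec flv :: "trm \<Rightarrow> nat set" and flvN :: "named \<Rightarrow> nat set" where
  "flv (LVar i) = {i}"
| "flv (Lam t) = {i. Suc i \<in> flv t}"
| "flv (App t u) = flv t \<union> flv u"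
| "flv (Mu c) = flvN c"
| "flvN (Name a t) = flv t"

primrec fmv :: "trm \<Rightarrow> nat set" and fmvN :: "named \<Rightarrow> nat set" where
  "fmv (LVar i) = {}"
| "fmv (Lam t) = fmv t"
| "fmv (App t u) = fmv t \<union> fmv u"
| "fmv (Mu c) = {a. Suc a \<in> fmvN c}"
| "fmvN (Name a t) = insert a (fmv t)"

definition closed_trm :: "trm \<Rightarrow> bool" where
  "closed_trm t \<longleftrightarrow> flv t = {} \<and> fmv t = {}"

subsection \<open>Renaming and substitution\<close>

definition ext :: "(nat \<Rightarrow> nat) \<Rightarrow> nat \<Rightarrow> nat" where
  "ext r i = (case i of 0 \<Rightarrow> 0 | Suc j \<Rightarrow> Suc (r j))"

primrec lren :: "(nat \<Rightarrow> nat) \<Rightarrow> trm \<Rightarrow> trm"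
  and lrenN :: "(nat \<Rightarrow> nat) \<Rightarrow> named \<Rightarrow> named" where
  "lren r (LVar i) = LVar (r i)"
| "lren r (Lam t) = Lam (lren (ext r) t)"
| "lren r (App t u) = App (lren r t) (lren r u)"
| "lren r (Mu c) = Mu (lrenN r c)"
| "lrenN r (Name a t) = Name a (lren r t)"

primrec mren :: "(nat \<Rightarrow> nat) \<Rightarrow> trm \<Rightarrow> trm"
  and mrenN :: "(nat \<Rightarrow> nat) \<Rightarrow> named \<Rightarrow> named" where
  "mren r (LVar i) = LVar i"
| "mren r (Lam t) = Lam (mren r t)"
| "mren r (App t u) = App (mren r t) (mren r u)"
| "mren r (Mu c) = Mu (mrenN (ext r) c)"
| "mrenN r (Name a t) = Name (r a) (mren r t)"

primrec lsubst :: "(nat \<Rightarrow> trm) \<Rightarrow> trm \<Rightarrow> trm"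
  and lsubstN :: "(nat \<Rightarrow> trm) \<Rightarrow> named \<Rightarrow> named" where
  "lsubst \<sigma> (LVar i) = \<sigma> i"
| "lsubst \<sigma> (Lam t) =
     Lam (lsubst (\<lambda>i. case i of 0 \<Rightarrow> LVar 0 | Suc j \<Rightarrow> lren Suc (\<sigma> j)) t)"
| "lsubst \<sigma> (App t u) = App (lsubst \<sigma> t) (lsubst \<sigma> u)"
| "lsubst \<sigma> (Mu c) = Mu (lsubstN (\<lambda>i. mren Suc (\<sigma> i)) c)"
| "lsubstN \<sigma> (Name a t) = Name a (lsubst \<sigma> t)"

text \<open>The structural substitution \<open>u[v/*\<alpha>]\<close>: every \<open>[\<alpha>]w\<close> in \<open>u\<close> becomes \<open>[\<alpha>](w)v\<close>.\<close>

primrec ssubst :: "nat \<Rightarrow> trm \<Rightarrow> trm \<Rightarrow> trm"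
  and ssubstN :: "nat \<Rightarrow> trm \<Rightarrow> named \<Rightarrow> named" where
  "ssubst a v (LVar i) = LVar i"
| "ssubst a v (Lam t) = Lam (ssubst a (lren Suc v) t)"
| "ssubst a v (App t u) = App (ssubst a v t) (ssubst a v u)"
| "ssubst a v (Mu c) = Mu (ssubstN (Suc a) (mren Suc v) c)"
| "ssubstN a v (Name b t) = Name b (if b = a then App (ssubst a v t) v else ssubst a v t)"

text \<open>\<open>occs a t\<close> is the set of all \<open>v\<close> such that \<open>[a]v\<close> is a subterm of \<open>t\<close>, where \<open>a\<close> is free
  in \<open>t\<close>. Each \<open>v\<close> keeps the indices it has at its own position in \<open>t\<close>.\<close>

primrec occs :: "nat \<Rightarrow> trm \<Rightarrow> trm set" and occsN :: "nat \<Rightarrow> named \<Rightarrow> trm set" where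
  "occs a (LVar i) = {}"
| "occs a (Lam t) = occs a t"
| "occs a (App t u) = occs a t \<union> occs a u"
| "occs a (Mu c) = occsN (Suc a) c"
| "occsN a (Name b t) = (if b = a then {t} else {}) \<union> occs a t"

subsection \<open>Reduction\<close>

inductive red :: "trm \<Rightarrow> trm \<Rightarrow> bool" and redN :: "named \<Rightarrow> named \<Rightarrow> bool" where
  C1: "red (App (Lam t) v) (lsubst (\<lambda>i. case i of 0 \<Rightarrow> v | Suc j \<Rightarrow> LVar j) t)"
| C2: "red (App (Mu c) v) (Mu (ssubstN 0 (mren Suc v) c))"
| S1: "redN (Name a (Mu c)) (mrenN (\<lambda>i. case i of 0 \<Rightarrow> a | Suc j \<Rightarrow> j) c)"
| S2: "0 \<notin> fmv t \<Longrightarrow> red (Mu (Name 0 t)) (mren (\<lambda>i. i - 1) t)"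
| S3: "Lam w \<in> occsN 0 c \<Longrightarrow> red (Mu c) (Lam (Mu (ssubstN 0 (LVar 0) (lrenN Suc c))))"
| Lam: "red t t' \<Longrightarrow> red (Lam t) (Lam t')"
| AppL: "red t t' \<Longrightarrow> red (App t u) (App t' u)"
| AppR: "red u u' \<Longrightarrow> red (App t u) (App t u')"
| Mu: "redN c c' \<Longrightarrow> red (Mu c) (Mu c')"
| Name: "red t t' \<Longrightarrow> redN (Name a t) (Name a t')"

definition normal :: "trm \<Rightarrow> bool" where
  "normal t \<longleftrightarrow> \<not> (\<exists>t'. red t t')"

section \<open>Types\<close>

text \<open>First-order terms over function symbols \<open>'f\<close>, with de Bruijn indices for variables.\<close>

datatype 'f tm = Var nat | Fn 'f "'f tm list"

text \<open>\<open>Rel\<close> is for the relation symbols \<open>'p\<close> of the language, if any. \<open>PVar i ts\<close> is the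
  relation variable number \<open>i\<close> among those of arity \<open>length ts\<close>: relation variables of distinct
  arities are indexed independently. \<open>AllT\<close> binds a first-order variable, and \<open>AllP k\<close> binds a
  relation variable of arity \<open>k\<close>.\<close>

datatype ('f, 'p) fm =
    Bot
  | Rel 'p "'f tm list"
  | PVar nat "'f tm list"
  | Imp "('f, 'p) fm" "('f, 'p) fm"
  | AllT "('f, 'p) fm"
  | AllP nat "('f, 'p) fm"

text \<open>Well-formedness with respect to the arities of the symbols of the language.\<close>

primrec wf_tm :: "('f \<Rightarrow> nat) \<Rightarrow> 'f tm \<Rightarrow> bool" where
  "wf_tm ar (Var i) \<longleftrightarrow> True"
| "wf_tm ar (Fn g ts) \<longleftrightarrow> length ts = ar g \<and> list_all (\<lambda>b. b) (map (wf_tm ar) ts)"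

primrec wf_fm :: "('f \<Rightarrow> nat) \<Rightarrow> ('p \<Rightarrow> nat) \<Rightarrow> ('f, 'p) fm \<Rightarrow> bool" where
  "wf_fm ar pr Bot \<longleftrightarrow> True"
| "wf_fm ar pr (Rel p ts) \<longleftrightarrow> length ts = pr p \<and> list_all (wf_tm ar) ts"
| "wf_fm ar pr (PVar i ts) \<longleftrightarrow> list_all (wf_tm ar) ts"
| "wf_fm ar pr (Imp A B) \<longleftrightarrow> wf_fm ar pr A \<and> wf_fm ar pr B"
| "wf_fm ar pr (AllT A) \<longleftrightarrow> wf_fm ar pr A"
| "wf_fm ar pr (AllP k A) \<longleftrightarrow> wf_fm ar pr A"

subsection \<open>First-order substitution\<close>

primrec tsubst :: "(nat \<Rightarrow> 'f tm) \<Rightarrow> 'f tm \<Rightarrow> 'f tm" where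
  "tsubst \<sigma> (Var i) = \<sigma> i"
| "tsubst \<sigma> (Fn g ts) = Fn g (map (tsubst \<sigma>) ts)"

definition shift_tm :: "'f tm \<Rightarrow> 'f tm" where
  "shift_tm = tsubst (\<lambda>i. Var (Suc i))"

primrec fsubst :: "(nat \<Rightarrow> 'f tm) \<Rightarrow> ('f, 'p) fm \<Rightarrow> ('f, 'p) fm" where
  "fsubst \<sigma> Bot = Bot"
| "fsubst \<sigma> (Rel p ts) = Rel p (map (tsubst \<sigma>) ts)"
| "fsubst \<sigma> (PVar i ts) = PVar i (map (tsubst \<sigma>) ts)"
| "fsubst \<sigma> (Imp A B) = Imp (fsubst \<sigma> A) (fsubst \<sigma> B)"
| "fsubst \<sigma> (AllT A) =
     AllT (fsubst (\<lambda>i. case i of 0 \<Rightarrow> Var 0 | Suc j \<Rightarrow> shift_tm (\<sigma> j)) A)"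
| "fsubst \<sigma> (AllP k A) = AllP k (fsubst \<sigma> A)"

definition shiftT :: "('f, 'p) fm \<Rightarrow> ('f, 'p) fm" where
  "shiftT = fsubst (\<lambda>i. Var (Suc i))"

definition instT :: "'f tm \<Rightarrow> ('f, 'p) fm \<Rightarrow> ('f, 'p) fm" where
  "instT u = fsubst (\<lambda>i. case i of 0 \<Rightarrow> u | Suc j \<Rightarrow> Var j)"

subsection \<open>Second-order substitution\<close>

primrec pren :: "(nat \<Rightarrow> nat \<Rightarrow> nat) \<Rightarrow> ('f, 'p) fm \<Rightarrow> ('f, 'p) fm" where
  "pren r Bot = Bot"
| "pren r (Rel p ts) = Rel p ts"
| "pren r (PVar i ts) = PVar (r (length ts) i) ts"
| "pren r (Imp A B) = Imp (pren r A) (pren r B)"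
| "pren r (AllT A) = AllT (pren r A)"
| "pren r (AllP k A) = AllP k (pren (r(k := ext (r k))) A)"

definition shiftP :: "nat \<Rightarrow> ('f, 'p) fm \<Rightarrow> ('f, 'p) fm" where
  "shiftP k = pren ((\<lambda>m i. i)(k := Suc))"

text \<open>A relation variable of arity \<open>k\<close> is replaced by a formula with \<open>k\<close> parameters
  \<open>x\<^sub>1, \<dots>, x\<^sub>k\<close>: in \<open>\<tau> k i\<close> the first-order indices below \<open>k\<close> are the parameters and the
  index \<open>j + k\<close> is the ambient variable \<open>j\<close>. The atom \<open>X(t\<^sub>1,\<dots>,t\<^sub>k)\<close> becomes
  \<open>G[t\<^sub>1/x\<^sub>1,\<dots>,t\<^sub>k/x\<^sub>k]\<close>.\<close>

definition pvar_fm :: "nat \<Rightarrow> nat \<Rightarrow> ('f, 'p) fm" where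
  "pvar_fm k i = PVar i (map Var [0..<k])"

primrec psubst :: "(nat \<Rightarrow> nat \<Rightarrow> ('f, 'p) fm) \<Rightarrow> ('f, 'p) fm \<Rightarrow> ('f, 'p) fm" where
  "psubst \<tau> Bot = Bot"
| "psubst \<tau> (Rel p ts) = Rel p ts"
| "psubst \<tau> (PVar i ts) =
     fsubst (\<lambda>j. if j < length ts then ts ! j else Var (j - length ts)) (\<tau> (length ts) i)"
| "psubst \<tau> (Imp A B) = Imp (psubst \<tau> A) (psubst \<tau> B)"
| "psubst \<tau> (AllT A) =
     AllT (psubst (\<lambda>k i. fsubst (\<lambda>j. Var (if j < k then j else Suc j)) (\<tau> k i)) A)"
| "psubst \<tau> (AllP m A) =
     AllP m (psubst (\<lambda>k i. if k = m
                then (case i of 0 \<Rightarrow> pvar_fm k 0 | Suc j \<Rightarrow> shiftP m (\<tau> k j))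
                else shiftP m (\<tau> k i)) A)"

definition instP :: "nat \<Rightarrow> ('f, 'p) fm \<Rightarrow> ('f, 'p) fm \<Rightarrow> ('f, 'p) fm" where
  "instP k G = psubst (\<lambda>m i. if m = k
      then (case i of 0 \<Rightarrow> G | Suc j \<Rightarrow> pvar_fm m j)
      else pvar_fm m i)"

subsection \<open>Equational consequence\<close>

inductive eq_cons :: "('f \<Rightarrow> nat) \<Rightarrow> ('f tm \<times> 'f tm) set \<Rightarrow> 'f tm \<Rightarrow> 'f tm \<Rightarrow> bool"
  for ar :: "'f \<Rightarrow> nat" and E :: "('f tm \<times> 'f tm) set" where
  ax: "(u, v) \<in> E \<Longrightarrow> \<forall>i. wf_tm ar (\<sigma> i) \<Longrightarrow> eq_cons ar E (tsubst \<sigma> u) (tsubst \<sigma> v)"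
| refl: "wf_tm ar u \<Longrightarrow> eq_cons ar E u u"
| sym: "eq_cons ar E u v \<Longrightarrow> eq_cons ar E v u"
| trans: "eq_cons ar E u v \<Longrightarrow> eq_cons ar E v w \<Longrightarrow> eq_cons ar E u w"
| cong: "length us = ar g \<Longrightarrow> list_all2 (eq_cons ar E) us vs \<Longrightarrow> eq_cons ar E (Fn g us) (Fn g vs)"

definition adequate :: "('f \<Rightarrow> nat) \<Rightarrow> 'f \<Rightarrow> 'f \<Rightarrow> ('f tm \<times> 'f tm) set \<Rightarrow> bool" where
  "adequate ar z s E \<longleftrightarrow>
     (\<forall>a. wf_tm ar a \<longrightarrow> \<not> eq_cons ar E (Fn s [a]) (Fn z [])) \<and>
     (\<forall>a b. wf_tm ar a \<longrightarrow> wf_tm ar b \<longrightarrow>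
        eq_cons ar E (Fn s [a]) (Fn s [b]) \<longrightarrow> eq_cons ar E a b)"

subsection \<open>Typing\<close>

text \<open>\<open>typing ar pr E \<Gamma> t A \<Delta>\<close> is the judgment \<open>\<Gamma> \<turnstile> t : A, \<Delta>\<close>. Position \<open>i\<close> of the list
  \<open>\<Gamma>\<close> (of \<open>\<Delta>\<close>) is the formula labelled by the lambda-variable (mu-variable) \<open>i\<close>. The
  contexts in rule \<open>var\<close> are arbitrary, so weakening is admissible and the discharged hypotheses
  in \<open>lam\<close> and in the two rules for mu may be left unused. Non-freeness of a quantified variable in
  the contexts is expressed by shifting the contexts.\<close>

inductive typing :: "('f \<Rightarrow> nat) \<Rightarrow> ('p \<Rightarrow> nat) \<Rightarrow> ('f tm \<times> 'f tm) set \<Rightarrow>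
    ('f, 'p) fm list \<Rightarrow> trm \<Rightarrow> ('f, 'p) fm \<Rightarrow> ('f, 'p) fm list \<Rightarrow> bool"
  for ar :: "'f \<Rightarrow> nat" and pr :: "'p \<Rightarrow> nat" and E :: "('f tm \<times> 'f tm) set" where
  var: "list_all (wf_fm ar pr) \<Gamma> \<Longrightarrow> list_all (wf_fm ar pr) \<Delta> \<Longrightarrow> i < length \<Gamma> \<Longrightarrow>
    typing ar pr E \<Gamma> (LVar i) (\<Gamma> ! i) \<Delta>"
| lam: "typing ar pr E (A # \<Gamma>) t B \<Delta> \<Longrightarrow> typing ar pr E \<Gamma> (Lam t) (Imp A B) \<Delta>"
| app: "typing ar pr E \<Gamma> u (Imp A B) \<Delta> \<Longrightarrow> typing ar pr E \<Gamma> v A \<Delta> \<Longrightarrow>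
    typing ar pr E \<Gamma> (App u v) B \<Delta>"
| allT_intro: "typing ar pr E (map shiftT \<Gamma>) t A (map shiftT \<Delta>) \<Longrightarrow>
    typing ar pr E \<Gamma> t (AllT A) \<Delta>"
| allT_elim: "typing ar pr E \<Gamma> t (AllT A) \<Delta> \<Longrightarrow> wf_tm ar u \<Longrightarrow>
    typing ar pr E \<Gamma> t (instT u A) \<Delta>"
| allP_intro: "typing ar pr E (map (shiftP k) \<Gamma>) t A (map (shiftP k) \<Delta>) \<Longrightarrow>
    typing ar pr E \<Gamma> t (AllP k A) \<Delta>"
| allP_elim: "typing ar pr E \<Gamma> t (AllP k A) \<Delta> \<Longrightarrow> wf_fm ar pr G \<Longrightarrow>
    typing ar pr E \<Gamma> t (instP k G A) \<Delta>"
| eq: "typing ar pr E \<Gamma> t (instT u A) \<Delta> \<Longrightarrow> wf_tm ar u \<Longrightarrow> wf_tm ar v \<Longrightarrow> eq_cons ar E u v \<Longrightarrow>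
    typing ar pr E \<Gamma> t (instT v A) \<Delta>"
| mu_other: "typing ar pr E \<Gamma> t A (B # \<Delta>) \<Longrightarrow> a < length \<Delta> \<Longrightarrow> \<Delta> ! a = A \<Longrightarrow>
    typing ar pr E \<Gamma> (Mu (Name (Suc a) t)) B \<Delta>"
| mu_same: "typing ar pr E \<Gamma> t B (B # \<Delta>) \<Longrightarrow> typing ar pr E \<Gamma> (Mu (Name 0 t)) B \<Delta>"

section \<open>Classical integers\<close>

primrec num :: "'f \<Rightarrow> 'f \<Rightarrow> nat \<Rightarrow> 'f tm" where
  "num z s 0 = Fn z []"
| "num z s (Suc n) = Fn s [num z s n]"

text \<open>Relation quantifiers do not bind first-order variables, so \<open>t\<close> needs no shifting here.\<close>

definition nat_fm :: "'f \<Rightarrow> 'f \<Rightarrow> 'f tm \<Rightarrow> ('f, 'p) fm" where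
  "nat_fm z s t =
     AllP 1 (Imp (PVar 0 [Fn z []])
       (Imp (AllT (Imp (PVar 0 [Var 0]) (PVar 0 [Fn s [Var 0]])))
         (PVar 0 [t])))"

definition classical_integer ::
  "('f \<Rightarrow> nat) \<Rightarrow> ('p \<Rightarrow> nat) \<Rightarrow> 'f \<Rightarrow> 'f \<Rightarrow> ('f tm \<times> 'f tm) set \<Rightarrow> nat \<Rightarrow> trm \<Rightarrow> bool" where
  "classical_integer ar pr z s E n \<theta> \<longleftrightarrow>
     closed_trm \<theta> \<and> typing ar pr E [] \<theta> (nat_fm z s (num z s n)) []"

text \<open>The terms of \<open>N\<^sub>x\<^sub>,\<^sub>f\<close> contain no lambda, hence the indices \<open>x\<close> and \<open>f\<close> are the same at
  every position.\<close>

inductive_set Nxf :: "nat \<Rightarrow> nat \<Rightarrow> trm set" for x f :: nat where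
  "LVar x \<in> Nxf x f"
| "Mu (Name b (LVar x)) \<in> Nxf x f"
| "u \<in> Nxf x f \<Longrightarrow> App (LVar f) u \<in> Nxf x f"
| "u \<in> Nxf x f \<Longrightarrow> Mu (Name b (App (LVar f) u)) \<in> Nxf x f"

lemma occs_size:
  "v \<in> occs a t \<Longrightarrow> size v < size t"
  "v \<in> occsN a c \<Longrightarrow> size v < size c"
  by (induction t and c arbitrary: a and a) (fastforce split: if_splits)+

text \<open>The values outside \<open>N\<^sub>x\<^sub>,\<^sub>f\<close> are irrelevant.\<close>

function val :: "nat \<Rightarrow> nat \<Rightarrow> trm \<Rightarrow> nat set" where
  "val x f (LVar i) = (if i = x then {0} else {})"
| "val x f (Lam t) = {}"
| "val x f (App t u) = (if t = LVar f then Suc ` val x f u else {})"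
| "val x f (Mu c) = (\<Union>v \<in> occsN 0 c. val x f v)"
  by pat_completeness auto
termination
  by (relation "measure (\<lambda>(x, f, t). size t)") (auto dest: occs_size(2))

end

theory Submission
  imports Defs
begin

text \<open>The typing rules are not syntax-directed: quantifiers may be introduced and instantiated
  between any two steps, and a mu-variable may carry an arbitrary type such as \<open>\<forall>X. X\<close>. Inverting a
  derivation is therefore replaced by a semantic argument. A formula denotes a set of marks
  (\<open>sem\<close>), where quantifiers are intersections, relation variables range over all predicates
  compatible with the equations, and arrows are interpreted by a fixed operation \<open>arr\<close>. A term
  denotes the least set of marks that it can be assigned (\<open>den\<close>); this is a syntax-directed system
  in which types are just sets of marks. The lemma \<open>soundness\<close> says that a term of type \<open>A\<close> has
  its denotation included in that of \<open>A\<close>, and everything after it is an induction on normal terms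
  that no longer mentions formulas.

  The marks record what has to be read off a type. For the proof, \<open>X\<close> is interpreted so that
  \<open>X(a)\<close> consists of the mark \<open>Numeric\<close> and of the marks \<open>Value k\<close> with \<open>a = s\<^sup>k 0\<close>. The mark
  \<open>Numeric\<close> lies in no arrow and \<open>Function\<close> lies in every arrow, so these two tell atomic types
  from arrows. The variable \<open>x\<close> and the normal applications have the mark \<open>Numeric\<close>
  (\<open>Numeric_App\<close>), hence are never applied; abstractions have the mark \<open>Function\<close>, hence are
  neither arguments of \<open>f\<close> nor named, once the named types are known to lack \<open>Function\<close>. This
  forces the body \<open>u\<close> of \<open>\<lambda>x \<lambda>f u\<close> into the set of terms \<open>Nxf\<close> (\<open>shape\<close>). Each value of such a
  term is a mark of its denotation (\<open>val_den\<close>), so each value \<open>k\<close> of \<open>u\<close> satisfies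
  \<open>s\<^sup>n 0 = s\<^sup>k 0\<close>, whence \<open>k = n\<close> by adequacy. Finally \<open>u\<close> has a value at all, because the
  innermost \<open>(f)\<^sup>k x\<close> always has one and a value is passed on to the binder of its name
  (\<open>val_nonempty\<close>).\<close>

section \<open>Marks and the interpretation of terms\<close>

text \<open>\<open>Successor\<close> marks the variable \<open>f\<close>. The marks \<open>Outer t\<close> and \<open>Inner u\<close> stand for the
  closures \<open>\<lambda>x t\<close> and \<open>\<lambda>f u\<close>: whether they lie in an arrow encodes what is to be proved about their
  bodies. Membership of a denotation in \<open>N[s\<^sup>n 0]\<close>, a nested arrow, then unfolds to the conclusion
  about \<open>u\<close>, although the arrows from which the type of the integer was obtained by
  instantiation are unknown.\<close>

datatype mark = Value nat | Numeric | Function | Successor | Inner trm | Outer trm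

text \<open>The indices in \<open>Nxf 1 0\<close> are those of \<open>x\<close> and \<open>f\<close> below both abstractions. In the clause for
  \<open>Successor\<close>, the condition on \<open>B\<close> is what forbids an abstraction as an argument of \<open>f\<close>, and
  \<open>Numeric \<in> C\<close> makes \<open>(f)v\<close> numeric even if \<open>v\<close> has no value, as for \<open>\<mu>\<alpha>[\<beta>]x\<close>. The
  alternative \<open>Numeric \<in> C\<close> for \<open>Outer\<close> covers bodies that are not abstractions; it fails when \<open>C\<close>
  is an arrow.\<close>

definition arr :: "mark set \<Rightarrow> mark set \<Rightarrow> mark set" where
  "arr B C = {m. case m of
      Value k \<Rightarrow> False
    | Numeric \<Rightarrow> False
    | Function \<Rightarrow> True
    | Successor \<Rightarrow> Function \<notin> B \<and> Numeric \<in> C \<and> (\<forall>k. Value k \<in> B \<longrightarrow> Value (Suc k) \<in> C)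
    | Inner u \<Rightarrow> {Function, Successor} \<subseteq> B \<longrightarrow> Function \<notin> C \<longrightarrow>
        u \<in> Nxf 1 0 \<and> (\<forall>k \<in> val 1 0 u. Value k \<in> C)
    | Outer t \<Rightarrow> {Numeric, Value 0} \<subseteq> B \<longrightarrow>
        Numeric \<in> C \<or> (\<exists>u. t = Lam u \<and> Inner u \<in> C)}"

lemma in_arr [simp]:
  "Value k \<notin> arr B C"
  "Numeric \<notin> arr B C"
  "Function \<in> arr B C"
  "Successor \<in> arr B C \<longleftrightarrow>
     Function \<notin> B \<and> Numeric \<in> C \<and> (\<forall>k. Value k \<in> B \<longrightarrow> Value (Suc k) \<in> C)"
  "Inner u \<in> arr B C \<longleftrightarrow> (Function \<in> B \<longrightarrow> Successor \<in> B \<longrightarrow> Function \<notin> C \<longrightarrow>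
     u \<in> Nxf 1 0 \<and> (\<forall>k \<in> val 1 0 u. Value k \<in> C))"
  "Outer t \<in> arr B C \<longleftrightarrow> (Numeric \<in> B \<longrightarrow> Value 0 \<in> B \<longrightarrow>
     Numeric \<in> C \<or> (\<exists>u. t = Lam u \<and> Inner u \<in> C))"
  by (auto simp: arr_def)

text \<open>An intersection over all types that the rule for the head constructor permits; for a term
  that no rule can type it is the empty intersection \<open>UNIV\<close>. Closure under intersection and
  enlargement is what absorbs the quantifier rules.\<close>

primrec den :: "trm \<Rightarrow> mark set list \<Rightarrow> mark set list \<Rightarrow> mark set"
  and okN :: "named \<Rightarrow> mark set list \<Rightarrow> mark set list \<Rightarrow> bool" where
  "den (LVar i) G D = (if i < length G then G ! i else UNIV)"
| "den (Lam t) G D = \<Inter>{arr B C | B C. den t (B # G) D \<subseteq> C}"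
| "den (App t u) G D = \<Inter>{C. \<exists>B. den t G D \<subseteq> arr B C \<and> den u G D \<subseteq> B}"
| "den (Mu c) G D = \<Inter>{B. okN c G (B # D)}"
| "okN (Name a t) G D \<longleftrightarrow> a < length D \<and> den t G D \<subseteq> D ! a"

section \<open>The interpretation of formulas\<close>

text \<open>The consequence relation \<open>eq_cons\<close> relates well-formed terms only, but the arguments of an
  atom occurring in a derivation are not visibly well-formed. \<open>cgr\<close> is its closure under formation
  of arbitrary terms, and adds nothing on well-formed ones.\<close>

inductive cgr :: "('f \<Rightarrow> nat) \<Rightarrow> ('f tm \<times> 'f tm) set \<Rightarrow> 'f tm \<Rightarrow> 'f tm \<Rightarrow> bool"
  for ar :: "'f \<Rightarrow> nat" and E :: "('f tm \<times> 'f tm) set" where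
  eq: "eq_cons ar E u v \<Longrightarrow> cgr ar E u v"
| var: "cgr ar E (Var i) (Var i)"
| fn: "list_all2 (cgr ar E) us vs \<Longrightarrow> cgr ar E (Fn g us) (Fn g vs)"

lemma cgr_tsubst:
  assumes "\<And>i. cgr ar E (e i) (e' i)"
  shows "cgr ar E (tsubst e t) (tsubst e' t)"
  by (induction t) (auto intro!: cgr.fn assms simp: list_all2_conv_all_nth)

lemma cgr_refl: "cgr ar E t t"
  by (induction t) (auto intro: cgr.var cgr.fn simp: list_all2_conv_all_nth)

lemma cgr_wf: "cgr ar E u v \<Longrightarrow> wf_tm ar u \<or> wf_tm ar v \<Longrightarrow> eq_cons ar E u v"
proof (induction rule: cgr.induct)
  case (fn us vs g)
  then have "length us = ar g" "list_all2 (eq_cons ar E) us vs"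
    by (auto simp: list_all2_conv_all_nth list_all_length)
  then show ?case
    by (rule eq_cons.cong)
qed (auto intro: eq_cons.refl)

definition congruential :: "('f \<Rightarrow> nat) \<Rightarrow> ('f tm \<times> 'f tm) set \<Rightarrow> ('f tm list \<Rightarrow> mark set) \<Rightarrow> bool" where
  "congruential ar E P \<longleftrightarrow> (\<forall>ds ds'. list_all2 (cgr ar E) ds ds' \<longrightarrow> P ds = P ds')"

text \<open>\<open>Bot\<close> and \<open>Rel\<close> may denote any constant sets, since no rule refers to them.\<close>

primrec sem :: "('f \<Rightarrow> nat) \<Rightarrow> ('f tm \<times> 'f tm) set \<Rightarrow> (nat \<Rightarrow> 'f tm) \<Rightarrow>
    (nat \<Rightarrow> nat \<Rightarrow> 'f tm list \<Rightarrow> mark set) \<Rightarrow> ('f, 'p) fm \<Rightarrow> mark set" where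
  "sem ar E e \<rho> Bot = {}"
| "sem ar E e \<rho> (Rel p ts) = {}"
| "sem ar E e \<rho> (PVar i ts) = \<rho> (length ts) i (map (tsubst e) ts)"
| "sem ar E e \<rho> (Imp A B) = arr (sem ar E e \<rho> A) (sem ar E e \<rho> B)"
| "sem ar E e \<rho> (AllT A) = (\<Inter>d\<in>{d. wf_tm ar d}. sem ar E (case_nat d e) \<rho> A)"
| "sem ar E e \<rho> (AllP k A) =
     (\<Inter>P\<in>{P. congruential ar E P}. sem ar E e (\<rho>(k := case_nat P (\<rho> k))) A)"

lemma tsubst_tsubst: "tsubst e (tsubst \<sigma> t) = tsubst (\<lambda>i. tsubst e (\<sigma> i)) t"
  by (induction t) auto

lemma sem_fsubst: "sem ar E e \<rho> (fsubst \<sigma> A) = sem ar E (\<lambda>i. tsubst e (\<sigma> i)) \<rho> A"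
proof (induction A arbitrary: e \<rho> \<sigma>)
  case (PVar i ts)
  then show ?case by (simp add: tsubst_tsubst comp_def)
next
  case (AllT A)
  have "(\<lambda>i. tsubst (case_nat d e) (case i of 0 \<Rightarrow> Var 0 | Suc j \<Rightarrow> shift_tm (\<sigma> j)))
    = case_nat d (\<lambda>i. tsubst e (\<sigma> i))" for d
    by (auto simp: fun_eq_iff shift_tm_def tsubst_tsubst split: nat.split)
  then show ?case by (simp add: AllT.IH)
qed auto

lemma sem_pren: "sem ar E e \<rho> (pren r A) = sem ar E e (\<lambda>k i. \<rho> k (r k i)) A"
proof (induction A arbitrary: e \<rho> r)
  case (AllP k A)
  have "(\<lambda>m i. (\<rho>(k := case_nat P (\<rho> k))) m ((r(k := ext (r k))) m i))
    = (\<lambda>m i. \<rho> m (r m i))(k := case_nat P (\<lambda>i. \<rho> k (r k i)))" for P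
    by (auto simp: fun_eq_iff ext_def split: nat.split)
  then show ?case by (simp add: AllP.IH)
qed auto

lemma sem_pvar_fm: "length ds = k \<Longrightarrow>
    sem ar E (\<lambda>j. if j < k then ds ! j else e j) \<rho> (pvar_fm k i) = \<rho> k i ds"
proof -
  assume "length ds = k"
  then have "map (\<lambda>j. if j < k then ds ! j else e j) [0..<k] = ds"
    by (auto intro: nth_equalityI)
  then show ?thesis by (simp add: pvar_fm_def comp_def)
qed

lemma sem_shiftP: "sem ar E e (\<rho>(k := case_nat P (\<rho> k))) (shiftP k A) = sem ar E e \<rho> A"
proof -
  have "(\<lambda>l j. (\<rho>(k := case_nat P (\<rho> k))) l (((\<lambda>m i. i)(k := Suc)) l j)) = \<rho>"
    by (auto simp: fun_eq_iff)
  then show ?thesis by (simp only: shiftP_def sem_pren)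
qed

text \<open>The interpretation \<open>\<rho>'\<close> is constrained at lists of the right length only: on other lists the
  predicate bound by \<open>AllP\<close> and the denotation of \<open>pvar_fm\<close> differ, so no closed expression for
  \<open>\<rho>'\<close> would be preserved under this binder.\<close>

lemma sem_psubst:
  assumes "\<And>k i ds. length ds = k \<Longrightarrow>
    \<rho>' k i ds = sem ar E (\<lambda>j. if j < k then ds ! j else e (j - k)) \<rho> (\<tau> k i)"
  shows "sem ar E e \<rho> (psubst \<tau> A) = sem ar E e \<rho>' A"
  using assms
proof (induction A arbitrary: e \<rho> \<rho>' \<tau>)
  case (PVar i ts)
  have "(\<lambda>j. tsubst e (if j < length ts then ts ! j else Var (j - length ts)))
    = (\<lambda>j. if j < length ts then map (tsubst e) ts ! j else e (j - length ts))"
    by auto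
  then show ?case by (simp add: sem_fsubst PVar.prems)
next
  case (Imp A B)
  show ?case by (simp add: Imp.IH(1)[OF Imp.prems] Imp.IH(2)[OF Imp.prems])
next
  case (AllT A)
  have "sem ar E (case_nat d e) \<rho> (psubst (\<lambda>k i. fsubst (\<lambda>j. Var (if j < k then j else Suc j)) (\<tau> k i)) A)
      = sem ar E (case_nat d e) \<rho>' A" for d
  proof (rule AllT.IH)
    fix k i and ds :: "'a tm list"
    assume ds: "length ds = k"
    have "(\<lambda>j. tsubst (\<lambda>j. if j < k then ds ! j else case_nat d e (j - k)) (Var (if j < k then j else Suc j)))
      = (\<lambda>j. if j < k then ds ! j else e (j - k))"
      by (auto simp: Suc_diff_le)
    then show "\<rho>' k i ds = sem ar E (\<lambda>j. if j < k then ds ! j else case_nat d e (j - k)) \<rho>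
        (fsubst (\<lambda>j. Var (if j < k then j else Suc j)) (\<tau> k i))"
      by (simp only: sem_fsubst AllT.prems[OF ds])
  qed
  then show ?case by simp
next
  case (AllP m A)
  have "sem ar E e (\<rho>(m := case_nat P (\<rho> m)))
      (psubst (\<lambda>k i. if k = m
                then (case i of 0 \<Rightarrow> pvar_fm k 0 | Suc j \<Rightarrow> shiftP m (\<tau> k j))
                else shiftP m (\<tau> k i)) A)
      = sem ar E e (\<rho>'(m := case_nat P (\<rho>' m))) A" for P
  proof (rule AllP.IH)
    fix k i and ds :: "'a tm list"
    assume "length ds = k"
    then show "(\<rho>'(m := case_nat P (\<rho>' m))) k i ds
      = sem ar E (\<lambda>j. if j < k then ds ! j else e (j - k)) (\<rho>(m := case_nat P (\<rho> m)))
         (if k = m then (case i of 0 \<Rightarrow> pvar_fm k 0 | Suc j \<Rightarrow> shiftP m (\<tau> k j))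
          else shiftP m (\<tau> k i))"
      by (cases "k = m"; cases i) (simp_all add: AllP.prems sem_pvar_fm sem_shiftP cong: if_cong)
  qed
  then show ?case by simp
qed auto

lemma sem_shiftT: "sem ar E (case_nat d e) \<rho> (shiftT A) = sem ar E e \<rho> A"
  by (simp add: shiftT_def sem_fsubst)

lemma sem_instT: "sem ar E e \<rho> (instT u A) = sem ar E (case_nat (tsubst e u) e) \<rho> A"
proof -
  have "(\<lambda>i. tsubst e (case i of 0 \<Rightarrow> u | Suc j \<Rightarrow> Var j)) = case_nat (tsubst e u) e"
    by (auto simp: fun_eq_iff split: nat.split)
  then show ?thesis by (simp only: instT_def sem_fsubst)
qed

text \<open>On lists of a length other than \<open>k\<close> the predicate is never consulted; the default \<open>{}\<close> keeps it
  congruential, where \<open>ds ! j\<close> would be unspecified.\<close>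

lemma sem_instP:
  "sem ar E e \<rho> (instP k G A) =
   sem ar E e (\<rho>(k := case_nat
     (\<lambda>ds. if length ds = k then sem ar E (\<lambda>j. if j < k then ds ! j else e (j - k)) \<rho> G else {})
     (\<rho> k))) A"
  unfolding instP_def
proof (rule sem_psubst)
  fix m i and ds :: "'a tm list"
  assume "length ds = m"
  then show "(\<rho>(k := case_nat
     (\<lambda>ds. if length ds = k then sem ar E (\<lambda>j. if j < k then ds ! j else e (j - k)) \<rho> G else {})
     (\<rho> k))) m i ds
    = sem ar E (\<lambda>j. if j < m then ds ! j else e (j - m)) \<rho>
       (if m = k then (case i of 0 \<Rightarrow> G | Suc j \<Rightarrow> pvar_fm m j) else pvar_fm m i)"
    by (cases "m = k"; cases i) (simp_all add: sem_pvar_fm cong: if_cong)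
qed

lemma sem_cgr:
  assumes "\<And>i. cgr ar E (e i) (e' i)" and "\<And>k i. congruential ar E (\<rho> k i)"
  shows "sem ar E e \<rho> A = sem ar E e' \<rho> A"
  using assms
proof (induction A arbitrary: e e' \<rho>)
  case (PVar i ts)
  then have "list_all2 (cgr ar E) (map (tsubst e) ts) (map (tsubst e') ts)"
    by (auto simp: list_all2_conv_all_nth intro: cgr_tsubst)
  with PVar show ?case by (auto simp: congruential_def)
next
  case (Imp A B)
  then show ?case by (metis sem.simps(4))
next
  case (AllT A)
  have "sem ar E (case_nat d e) \<rho> A = sem ar E (case_nat d e') \<rho> A" for d
    using AllT.prems by (intro AllT.IH) (auto intro: cgr_refl split: nat.split)
  then show ?case by simp
next
  case (AllP k A)
  have "sem ar E e (\<rho>(k := case_nat P (\<rho> k))) A = sem ar E e' (\<rho>(k := case_nat P (\<rho> k))) A"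
    if "congruential ar E P" for P
    using AllP.prems that by (intro AllP.IH) (auto split: nat.split)
  then show ?case by simp
qed auto

section \<open>Soundness\<close>

lemma wf_tm_tsubst: "wf_tm ar t \<Longrightarrow> \<forall>i. wf_tm ar (e i) \<Longrightarrow> wf_tm ar (tsubst e t)"
  by (induction t) (auto simp: list_all_iff)

lemma eq_cons_tsubst:
  assumes "eq_cons ar E u v" and "\<forall>i. wf_tm ar (e i)"
  shows "eq_cons ar E (tsubst e u) (tsubst e v)"
  using assms
proof (induction rule: eq_cons.induct)
  case (ax u v \<sigma>)
  then show ?case
    by (auto simp: tsubst_tsubst intro: eq_cons.ax wf_tm_tsubst)
next
  case (cong us g vs)
  then show ?case
    by (auto simp: list_all2_conv_all_nth intro!: eq_cons.cong)
qed (auto intro: eq_cons.intros wf_tm_tsubst)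

text \<open>Shifting a context is undone by extending the environment, so the introduction rules for
  quantifiers become intersections over all extensions. Elimination picks one member of such an
  intersection, and the equality rule leaves the denotation of the formula unchanged.\<close>

lemma soundness:
  assumes "typing ar pr E \<Gamma> t A \<Delta>"
    and "\<forall>i. wf_tm ar (e i)" and "\<forall>k i. congruential ar E (\<rho> k i)"
  shows "den t (map (sem ar E e \<rho>) \<Gamma>) (map (sem ar E e \<rho>) \<Delta>) \<subseteq> sem ar E e \<rho> A"
  using assms
proof (induction arbitrary: e \<rho> rule: typing.induct)
  case (lam A \<Gamma> t B \<Delta>)
  have "den t (sem ar E e \<rho> A # map (sem ar E e \<rho>) \<Gamma>) (map (sem ar E e \<rho>) \<Delta>) \<subseteq> sem ar E e \<rho> B"
    using lam.IH[OF lam.prems] by simp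
  then show ?case by (simp only: den.simps sem.simps) (rule Inter_lower, blast)
next
  case (app \<Gamma> u A B \<Delta> v)
  have "den u (map (sem ar E e \<rho>) \<Gamma>) (map (sem ar E e \<rho>) \<Delta>) \<subseteq> arr (sem ar E e \<rho> A) (sem ar E e \<rho> B)"
    "den v (map (sem ar E e \<rho>) \<Gamma>) (map (sem ar E e \<rho>) \<Delta>) \<subseteq> sem ar E e \<rho> A"
    using app.IH app.prems by simp_all
  then show ?case by (simp only: den.simps) (rule Inter_lower, blast)
next
  case (allT_intro \<Gamma> t A \<Delta>)
  have "den t (map (sem ar E e \<rho>) \<Gamma>) (map (sem ar E e \<rho>) \<Delta>) \<subseteq> sem ar E (case_nat d e) \<rho> A"
    if "wf_tm ar d" for d
    using allT_intro.IH[of "case_nat d e" \<rho>] allT_intro.prems that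
    by (simp add: comp_def sem_shiftT split: nat.split)
  then show ?case by auto
next
  case (allT_elim \<Gamma> t A \<Delta> u)
  have "sem ar E e \<rho> (AllT A) \<subseteq> sem ar E e \<rho> (instT u A)"
    using wf_tm_tsubst[OF allT_elim.hyps(2) allT_elim.prems(1)] by (auto simp: sem_instT)
  with allT_elim.IH[OF allT_elim.prems] show ?case by blast
next
  case (allP_intro k \<Gamma> t A \<Delta>)
  have "den t (map (sem ar E e \<rho>) \<Gamma>) (map (sem ar E e \<rho>) \<Delta>)
      \<subseteq> sem ar E e (\<rho>(k := case_nat P (\<rho> k))) A"
    if "congruential ar E P" for P
  proof -
    have "\<forall>l i. congruential ar E ((\<rho>(k := case_nat P (\<rho> k))) l i)"
      using allP_intro.prems that by (auto split: nat.split)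
    from allP_intro.IH[OF allP_intro.prems(1) this] show ?thesis
      by (simp only: map_map comp_def sem_shiftP)
  qed
  then show ?case by auto
next
  case (allP_elim \<Gamma> t k A \<Delta> G)
  have "sem ar E (\<lambda>j. if j < k then ds ! j else e (j - k)) \<rho> G =
      sem ar E (\<lambda>j. if j < k then ds' ! j else e (j - k)) \<rho> G"
    if "list_all2 (cgr ar E) ds ds'" "length ds = k" for ds ds'
    using that allP_elim.prems by (intro sem_cgr) (auto simp: cgr_refl list_all2_conv_all_nth)
  then have "congruential ar E (\<lambda>ds. if length ds = k
      then sem ar E (\<lambda>j. if j < k then ds ! j else e (j - k)) \<rho> G else {})"
    unfolding congruential_def by (auto dest: list_all2_lengthD)
  then have "sem ar E e \<rho> (AllP k A) \<subseteq> sem ar E e \<rho> (instP k G A)"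
    by (auto simp: sem_instP)
  with allP_elim.IH[OF allP_elim.prems] show ?case by blast
next
  case (eq \<Gamma> t u A \<Delta> v)
  have "sem ar E e \<rho> (instT u A) = sem ar E e \<rho> (instT v A)"
    unfolding sem_instT using eq_cons_tsubst[OF eq.hyps(4) eq.prems(1)] eq.prems(2)
    by (intro sem_cgr) (auto intro: cgr.eq cgr_refl split: nat.split)
  with eq.IH[OF eq.prems] show ?case by simp
next
  case (mu_other \<Gamma> t A B \<Delta> a)
  then have "den t (map (sem ar E e \<rho>) \<Gamma>) (sem ar E e \<rho> B # map (sem ar E e \<rho>) \<Delta>)
      \<subseteq> map (sem ar E e \<rho>) \<Delta> ! a"
    by auto
  with mu_other.hyps show ?case by (auto simp: Inter_lower)
next
  case (mu_same \<Gamma> t B \<Delta>)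
  then show ?case by (auto simp: Inter_lower)
qed simp

section \<open>Normal terms\<close>

lemma normal_Lam: "normal (Lam t) \<Longrightarrow> normal t"
  by (auto simp: normal_def intro: red_redN.Lam)

lemma normal_App:
  assumes "normal (App t u)"
  shows "normal t" "normal u" "t \<noteq> Lam t'" "t \<noteq> Mu c"
  using assms by (auto simp: normal_def intro: red_redN.intros)

lemma normal_Mu:
  assumes "normal (Mu (Name a t))"
  shows "normal t" "t \<noteq> Mu c" "a = 0 \<Longrightarrow> t \<noteq> LVar i" "a = 0 \<Longrightarrow> t \<noteq> Lam w"
proof -
  show "normal t" "t \<noteq> Mu c"
    using assms unfolding normal_def by (blast intro: red_redN.intros)+
  show "t \<noteq> LVar i" if "a = 0"
    using assms that red_redN.S2[of "LVar i"] by (auto simp: normal_def)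
  show "t \<noteq> Lam w" if "a = 0"
    using assms that red_redN.S3[of w "Name 0 (Lam w)"] by (auto simp: normal_def)
qed

text \<open>The head of a normal application is a variable. A numeric head cannot be applied, so that the
  application has no type and denotes \<open>UNIV\<close>; the head \<open>f\<close> gives numeric results.\<close>

lemma Numeric_App:
  assumes "normal (App t u)" and "\<forall>S\<in>set G. Numeric \<in> S \<or> Successor \<in> S"
  shows "Numeric \<in> den (App t u) G D"
  using assms
proof (induction t arbitrary: u rule: trm.induct[where ?P2.0="\<lambda>_. True"])
  case (LVar i)
  have "Numeric \<in> C" if "den (LVar i) G D \<subseteq> arr B C" for B C
  proof (cases "i < length G")
    case True
    with that have "G ! i \<subseteq> arr B C" by simp
    moreover have "Numeric \<in> G ! i \<or> Successor \<in> G ! i" using LVar.prems True by auto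
    ultimately show ?thesis by (metis in_arr(2,4) subsetD)
  next
    case False
    with that have "Numeric \<in> arr B C" by (simp add: subset_iff)
    then show ?thesis by simp
  qed
  then show ?case by auto
next
  case (App t1 t2)
  then have "Numeric \<in> den (App t1 t2) G D"
    by (blast dest: normal_App(1))
  then have "\<not> den (App t1 t2) G D \<subseteq> arr B C" for B C
    by (metis in_arr(2) subsetD)
  then show ?case by (simp only: den.simps(3)[of "App t1 t2"]) simp
qed (auto dest: normal_App)

text \<open>The only mu-abstractions without free mu-variables to consider are \<open>\<mu>\<alpha>[\<alpha>]t\<close>. Normality
  leaves only applications for \<open>t\<close>: a variable admits \<open>S2\<close>, a mu-abstraction \<open>S1\<close>, and an abstraction
  \<open>S3\<close>.\<close>

lemma Lam_or_Numeric:
  assumes "normal t" and "fmv t = {}" and "\<forall>S\<in>set G. Numeric \<in> S"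
  shows "(\<exists>u. t = Lam u) \<or> Numeric \<in> den t G D"
proof (cases t)
  case (LVar i)
  with assms show ?thesis by auto
next
  case (App u v)
  with assms show ?thesis by (simp del: den.simps add: Numeric_App)
next
  case (Mu c)
  obtain a t' where c: "c = Name a t'" by (cases c)
  have a: "a = 0" using assms(2) Mu c by (cases a) auto
  have "normal (Mu (Name 0 t'))" using assms(1) Mu c a by simp
  note n = normal_Mu[OF this]
  obtain u v where t': "t' = App u v" using n by (cases t') auto
  have "Numeric \<in> den t' G D'" for D'
    unfolding t' by (rule Numeric_App) (use n t' assms in auto)
  then show ?thesis using Mu c a by auto
qed auto

section \<open>Shape\<close>

text \<open>The absence of \<open>Function\<close> is passed down: for \<open>(f)v\<close> the mark \<open>Successor\<close> keeps it out of the
  type of \<open>v\<close>, and for \<open>\<mu>\<alpha>[\<beta>]t\<close> a type without it can be added to \<open>D\<close>, so that the type of \<open>t\<close>,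
  which is in the extended \<open>D\<close>, lacks it as well. The predicate for named terms is about the term
  under the name because normality is a property of terms.\<close>

lemma shape:
  assumes "normal t" and "Function \<in> W" and "Successor \<in> W" and "Numeric \<in> Z"
    and "\<forall>S\<in>set D. Function \<notin> S" and "Function \<notin> den t [W, Z] D"
  shows "t \<in> Nxf 1 0"
  using assms
proof (induction t arbitrary: D rule: trm.induct[where ?P2.0="\<lambda>c. case c of Name b t \<Rightarrow> \<forall>D.
     normal t \<longrightarrow> (\<forall>S\<in>set D. Function \<notin> S) \<longrightarrow> Function \<notin> den t [W, Z] D \<longrightarrow> t \<in> Nxf 1 0"])
  case (LVar i)
  then have "i = 1" by (auto simp: nth_Cons split: if_splits nat.splits)
  then show ?case by (simp add: Nxf.intros)
next
  case (Lam t)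
  then show ?case by auto
next
  case (App t u)
  obtain B C where BC: "den t [W, Z] D \<subseteq> arr B C" "den u [W, Z] D \<subseteq> B"
    using App.prems(6) by auto
  have "Numeric \<notin> den t [W, Z] D" using BC by (metis in_arr(2) subsetD)
  then obtain i where t: "t = LVar i"
    using normal_App[OF App.prems(1)] App.prems Numeric_App[of _ _ "[W, Z]" D]
    by (cases t) (auto simp del: den.simps)
  have "i = 0"
    using \<open>Numeric \<notin> _\<close> App.prems by (auto simp: t nth_Cons split: if_splits nat.splits)
  with BC t App.prems have "Successor \<in> arr B C" by auto
  with BC have "Function \<notin> den u [W, Z] D" by auto
  with App normal_App(2) have "u \<in> Nxf 1 0" by blast
  with t \<open>i = 0\<close> show ?case by (simp add: Nxf.intros)
next
  case (Mu c)
  obtain a t where c: "c = Name a t" by (cases c)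
  from Mu.prems(6) obtain B where B: "Function \<notin> B" "a < length (B # D)"
    "den t [W, Z] (B # D) \<subseteq> (B # D) ! a"
    by (auto simp: c)
  have D: "\<forall>S\<in>set (B # D). Function \<notin> S" using B(1) Mu.prems(5) by simp
  then have "Function \<notin> den t [W, Z] (B # D)" using B(2,3) nth_mem by blast
  note n = normal_Mu[OF Mu.prems(1)[unfolded c]]
  have "t \<in> Nxf 1 0"
    using Mu(1) n(1) D \<open>Function \<notin> den t _ _\<close> unfolding c named.case by blast
  then show ?case using n(2) unfolding c by cases (auto intro: Nxf.intros)
next
  case (Name a t)
  then show ?case using assms by auto
qed

section \<open>Values\<close>

text \<open>Merging the rules for naming \<open>x\<close> and \<open>(f)u\<close> into one step, which holds for all named terms,
  avoids repeating the treatment of mu-abstractions.\<close>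

lemma Nxf_Mu_induct [consumes 1, case_names x f mu]:
  assumes "u \<in> Nxf x f"
    and "P (LVar x)"
    and "\<And>u. u \<in> Nxf x f \<Longrightarrow> P u \<Longrightarrow> P (App (LVar f) u)"
    and "\<And>b u. u \<in> Nxf x f \<Longrightarrow> P u \<Longrightarrow> P (Mu (Name b u))"
  shows "P u"
  using assms(1) by induction (auto intro: assms Nxf.intros)

text \<open>A value of \<open>\<mu>\<alpha>c\<close> comes from some \<open>[\<alpha>]v\<close> deep inside \<open>c\<close>, hence the second statement about
  the types of mu-variables. It holds for typable terms only, that is, if the denotation is not
  \<open>UNIV\<close>; excluding \<open>UNIV\<close> from \<open>D\<close> makes typability pass to named subterms.\<close>

lemma val_den:
  assumes "t \<in> Nxf 1 0" and "Successor \<in> W" and "Value 0 \<in> Z" and "UNIV \<notin> set D"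
  shows "\<forall>k\<in>val 1 0 t. Value k \<in> den t [W, Z] D"
    and "den t [W, Z] D \<noteq> UNIV \<longrightarrow> (\<forall>a. \<forall>v\<in>occs a t. \<forall>k\<in>val 1 0 v. Value k \<in> D ! a)"
  using assms(1,4)
proof (induction arbitrary: D rule: Nxf_Mu_induct)
  case x
  { case 1 show ?case using assms by simp }
  { case 2 show ?case by simp }
next
  case (f u)
  have suc: "Function \<notin> B \<and> (\<forall>k. Value k \<in> B \<longrightarrow> Value (Suc k) \<in> C)"
    if "den (LVar 0) [W, Z] D \<subseteq> arr B C" for B C and D :: "mark set list"
  proof -
    have "Successor \<in> arr B C" using that assms(2) by auto
    then show ?thesis by simp
  qed
  { case 1 then show ?case using f.IH(1)[of D] suc by (auto; blast) }
  { case 2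
    show ?case
    proof
      assume "den (App (LVar 0) u) [W, Z] D \<noteq> UNIV"
      then obtain B C where "den (LVar 0) [W, Z] D \<subseteq> arr B C" "den u [W, Z] D \<subseteq> B"
        by auto
      with suc[of D B C] have "den u [W, Z] D \<noteq> UNIV" by blast
      with f.IH(2)[OF 2] show "\<forall>a. \<forall>v\<in>occs a (App (LVar 0) u). \<forall>k\<in>val 1 0 v. Value k \<in> D ! a"
        by simp
    qed }
next
  case (mu b u)
  have *: "\<forall>v\<in>occsN a (Name b u). \<forall>k\<in>val 1 0 v. Value k \<in> (B # D) ! a"
    if "okN (Name b u) [W, Z] (B # D)" "B \<noteq> UNIV" "UNIV \<notin> set D" for a B and D :: "mark set list"
  proof -
    have D: "UNIV \<notin> set (B # D)" using that by auto
    have ok: "b < length (B # D)" "den u [W, Z] (B # D) \<subseteq> (B # D) ! b" using that by auto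
    have "den u [W, Z] (B # D) \<noteq> UNIV" using ok D nth_mem by (metis top.extremum_unique)
    then show ?thesis using mu.IH[OF D] ok by auto
  qed
  { case 1
    show ?case
    proof
      fix k assume "k \<in> val 1 0 (Mu (Name b u))"
      then obtain v where v: "v \<in> occsN 0 (Name b u)" "k \<in> val 1 0 v" by auto
      have "Value k \<in> B" if "okN (Name b u) [W, Z] (B # D)" for B
        using *[OF that _ 1, of 0] v by (cases "B = UNIV") auto
      then show "Value k \<in> den (Mu (Name b u)) [W, Z] D" by auto
    qed }
  { case 2
    show ?case
    proof
      assume "den (Mu (Name b u)) [W, Z] D \<noteq> UNIV"
      then obtain B where "okN (Name b u) [W, Z] (B # D)" "B \<noteq> UNIV" by auto
      from *[OF this 2, of "Suc _"]
      show "\<forall>a. \<forall>v\<in>occs a (Mu (Name b u)). \<forall>k\<in>val 1 0 v. Value k \<in> D ! a" by simp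
    qed }
qed

text \<open>These terms have no branching, so a chain of names leads from the innermost \<open>x\<close> outwards:
  either a value reaches the root or it is sent to a free mu-variable.\<close>

lemma val_nonempty:
  assumes "u \<in> Nxf x f"
  shows "val x f u \<noteq> {} \<or> (\<exists>a\<in>fmv u. \<exists>v\<in>occs a u. val x f v \<noteq> {})"
  using assms
proof (induction rule: Nxf_Mu_induct)
  case (mu b u)
  then obtain a v where av: "a \<in> fmvN (Name b u)" "v \<in> occsN a (Name b u)" "val x f v \<noteq> {}"
    by fastforce
  show ?case
  proof (cases a)
    case 0
    with av show ?thesis by auto
  next
    case (Suc a')
    with av show ?thesis by (intro disjI2 bexI[of _ a']) auto
  qed
qed auto

section \<open>Integers\<close>

lemma eq_cons_wf:
  assumes "eq_cons ar E u v" and "\<forall>(u, v)\<in>E. wf_tm ar u \<and> wf_tm ar v"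
  shows "wf_tm ar u \<and> wf_tm ar v"
  using assms
  by (induction rule: eq_cons.induct)
    (auto simp: list_all_length list_all2_conv_all_nth intro!: wf_tm_tsubst)

lemma wf_num: "ar z = 0 \<Longrightarrow> ar s = 1 \<Longrightarrow> wf_tm ar (num z s n)"
  by (induction n) auto

lemma num_inject:
  assumes "adequate ar z s E" and "ar z = 0" and "ar s = 1"
    and "eq_cons ar E (num z s n) (num z s k)"
  shows "n = k"
  using assms(4)
proof (induction n arbitrary: k)
  case 0
  then show ?case
    using assms(1) eq_cons.sym[OF 0] wf_num[of ar z s, OF assms(2,3)]
    by (cases k) (auto simp: adequate_def)
next
  case (Suc n)
  then show ?case
    using assms(1) wf_num[of ar z s, OF assms(2,3)]
    by (cases k) (auto simp: adequate_def)
qed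

text \<open>This is where the clauses of \<open>arr\<close> for \<open>Inner\<close> and \<open>Outer\<close> are justified: every type of \<open>\<lambda>x t\<close>
  is an intersection of arrows given by typings of \<open>t\<close>.\<close>

lemma Outer_closed:
  assumes "normal t" and "fmv t = {}"
  shows "Outer t \<in> den (Lam t) [] []"
proof -
  have "Outer t \<in> arr B C" if C: "den t [B] [] \<subseteq> C" for B C
  proof -
    have "\<exists>u. t = Lam u \<and> Inner u \<in> C" if B: "Numeric \<in> B" "Value 0 \<in> B" "Numeric \<notin> C"
    proof -
      obtain u where t: "t = Lam u"
        using Lam_or_Numeric[OF assms, of "[B]" "[]"] B C by auto
      have "Inner u \<in> arr W C'" if "den u [W, B] [] \<subseteq> C'" for W C'
        using that B normal_Lam[of u] assms(1) shape[of u W B "[]"] val_den(1)[of u W B "[]"] t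
        by auto
      then have "Inner u \<in> den t [B] []" by (auto simp: t)
      with C t show ?thesis by blast
    qed
    then show ?thesis by (simp only: in_arr) blast
  qed
  then show ?thesis by auto
qed

theorem mainTheorem1:
  fixes ar :: "'f \<Rightarrow> nat" and pr :: "'p \<Rightarrow> nat" and z s :: 'f
    and E :: "('f tm \<times> 'f tm) set" and n :: nat and \<theta> :: trm
  assumes "ar z = 0" and "ar s = 1"
    and "\<forall>(u, v) \<in> E. wf_tm ar u \<and> wf_tm ar v"
    and "adequate ar z s E"
    and "classical_integer ar pr z s E n \<theta>"
    and "normal \<theta>"
  shows "\<exists>u. \<theta> = Lam (Lam u) \<and> u \<in> Nxf 1 0 \<and> fmv u = {} \<and> val 1 0 u = {n}"
proof -
  \<comment> \<open>The intended interpretation of the relation variable quantified in \<open>N[x]\<close>.\<close>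
  define X where
    "X ds = insert Numeric {Value k | k. \<exists>d. ds = [d] \<and> eq_cons ar E d (num z s k)}" for ds
  have "congruential ar E X"
    unfolding congruential_def
  proof (intro allI impI)
    fix ds ds' assume *: "list_all2 (cgr ar E) ds ds'"
    have "eq_cons ar E d (num z s k) \<longleftrightarrow> eq_cons ar E d' (num z s k)" if "cgr ar E d d'" for d d' k
      using cgr_wf[OF that] eq_cons_wf[OF _ assms(3)] by (meson eq_cons.sym eq_cons.trans)
    with * show "X ds = X ds'" by (fastforce simp: X_def list_all2_Cons1 list_all2_Cons2)
  qed
  \<comment> \<open>The denotation of the type of \<open>f\<close>.\<close>
  define W where "W = (\<Inter>d\<in>{d. wf_tm ar d}. arr (X [d]) (X [Fn s [d]]))"
  have closed: "fmv \<theta> = {}" and ty: "typing ar pr E [] \<theta> (nat_fm z s (num z s n)) []"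
    using assms(5) by (auto simp: classical_integer_def closed_trm_def)
  have num_Var: "tsubst Var t = t" for t :: "'f tm"
    by (induction t) (auto intro: map_idI)
  have "den \<theta> [] [] \<subseteq> sem ar E Var (\<lambda>_ _ _. {}) (nat_fm z s (num z s n) :: ('f, 'p) fm)"
    using soundness[OF ty, of Var "\<lambda>_ _ _. {}"] by (simp add: congruential_def)
  also have "\<dots> \<subseteq> arr (X [num z s 0]) (arr W (X [num z s n]))"
    using \<open>congruential ar E X\<close> by (auto simp: nat_fm_def W_def num_Var)
  finally have den: "den \<theta> [] [] \<subseteq> arr (X [num z s 0]) (arr W (X [num z s n]))" .
  obtain t where \<theta>: "\<theta> = Lam t"
    using Lam_or_Numeric[OF assms(6) closed, of "[]" "[]"] den by auto
  have "Outer t \<in> den \<theta> [] []"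
    unfolding \<theta> by (rule Outer_closed) (use assms(6) closed in \<open>auto simp: \<theta> dest: normal_Lam\<close>)
  with den have "Outer t \<in> arr (X [num z s 0]) (arr W (X [num z s n]))" by blast
  moreover have "Numeric \<in> X [num z s 0]" "Value 0 \<in> X [num z s 0]"
    using wf_num[of ar z s 0] assms(1,2) by (auto simp: X_def intro: eq_cons.refl)
  ultimately obtain u where u: "t = Lam u" "Inner u \<in> arr W (X [num z s n])"
    by auto
  have "Successor \<in> W"
    using assms(2) by (auto simp: W_def X_def intro!: eq_cons.cong)
  moreover have "Function \<in> W" "Function \<notin> X [num z s n]"
    by (auto simp: W_def X_def)
  ultimately have Nxf: "u \<in> Nxf 1 0" and vals: "\<forall>k\<in>val 1 0 u. Value k \<in> X [num z s n]"
    using u(2) by auto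
  have "fmv u = {}" using closed \<theta> u(1) by simp
  have "k = n" if "k \<in> val 1 0 u" for k
    using vals that num_inject[OF assms(4,1,2), of n k] by (auto simp: X_def)
  moreover have "val 1 0 u \<noteq> {}"
    using val_nonempty[OF Nxf] \<open>fmv u = {}\<close> by simp
  ultimately have "val 1 0 u = {n}" by blast
  with \<theta> u(1) Nxf \<open>fmv u = {}\<close> show ?thesis by blast
qed

end
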